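(* Let $\mathbb{K}$ be a field and let $I\subset\mathbb{K}[X_1,\dots,X_n]$ be a symmetric ideal. Assume that there exists $P\in I$ of degree $d$ such that $d+\mathrm{wt}(P_d)\le n$. Then, for every monomial $m\in\mathrm{Mon}(P_d)$, the ideal $I$ contains every Specht polynomial $\mathrm{sp}_T$ for which the shape of $T$ is dominated by $\mu(m)^\perp$. In other words, $I^{\mathrm{sp}}_\lambda\subset I$ for every partition $\lambda$ of $n$ with $\lambda\trianglelefteq\mu(m)^\perp$.
   Context: The symmetric group $S_n$ acts on $\mathbb{K}[X_1,\dots,X_n]$ by permuting the variables; an ideal $I$ is symmetric if $\sigma P\in I$ for all $P\in I$, $\sigma\in S_n$. For a polynomial $P$, $P_h$ is its homogeneous component of degree $h$ and $\mathrm{Mon}(P)$ is the set of monomials appearing in $P$ (with nonzero coefficient). The support of a monomial $m=\prod_j X_j^{k_j}$ is $\{j: k_j\ne0\}$, and its weight $\mathrm{wt}(m)$ is the cardinality of its support; $\mathrm{Supp}(P)$ is the union of the supports of the monomials in $\mathrm{Mon}(P)$ and $\mathrm{wt}(P)=|\mathrm{Supp}(P)|$. A partition of $n$ is a weakly decreasing sequence of positive integers with sum $n$; $\mathrm{len}$ denotes the number of parts. The dual partition $\lambda^\perp$ is given by $(\lambda^\perp)_i=|\{j:\lambda_j\ge i\}|$. For partitions $\lambda,\mu$ of $n$, $\mu$ dominates $\lambda$ (written $\lambda\trianglelefteq\mu$) if $\sum_{j=1}^i\mu_j\ge\sum_{j=1}^i\lambda_j$ for all $1\le i\le\min\{\mathrm{len}(\lambda),\mathrm{len}(\mu)\}$.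 For a monomial $m$ of degree $d$ and weight $l$ with $d+l\le n$, let $(\lambda_1,\dots,\lambda_l)$ be the partition of $d$ formed by the nonzero exponents of $m$ in decreasing order; then $\mu(m)$ is the partition of $n$ given by $\mu(m)=(\lambda_1+1,\dots,\lambda_l+1,1,\dots,1)$ with $n-d-l$ trailing ones. A Young tableau $T$ of shape $\lambda$ is a filling of the Young diagram with $\lambda_i$ boxes (left-justified) in row $i$ by the numbers $1,\dots,n$, each used exactly once. For $S=\{i_1,\dots,i_r\}\subset\{1,\dots,n\}$ put $\Delta(S)=\prod_{1\le j<k\le r}(X_{i_j}-X_{i_k})$. The Specht polynomial of $T$ is $\mathrm{sp}_T=\prod_c\Delta(T_{\cdot,c})$, where $c$ runs over the columns of $T$ and $T_{\cdot,c}$ is the list of entries of the $c$-th column. The ideal $I^{\mathrm{sp}}_\lambda$ of $\mathbb{K}[X_1,\dots,X_n]$ is generated by all $\mathrm{sp}_T$ with $T$ of shape $\lambda$. *)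

theory Defs
  imports
    "HOL-Library.Poly_Mapping"
    "HOL-Combinatorics.Permutations"
    "HOL-Algebra.Ideal"
begin

type_synonym monom = "nat \<Rightarrow>\<^sub>0 nat"
type_synonym 'k mvpoly = "monom \<Rightarrow>\<^sub>0 'k"

definition Var :: "nat \<Rightarrow> 'k::comm_ring_1 mvpoly" where
  "Var i = Poly_Mapping.single (Poly_Mapping.single i 1) 1"

definition Const :: "'k::comm_ring_1 \<Rightarrow> 'k mvpoly" where
  "Const c = Poly_Mapping.single 0 c"

definition Mon :: "'k::comm_ring_1 mvpoly \<Rightarrow> monom set" where
  "Mon P = Poly_Mapping.keys P"

definition mon_supp :: "monom \<Rightarrow> nat set" where
  "mon_supp m = Poly_Mapping.keys m"

definition mon_wt :: "monom \<Rightarrow> nat" where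
  "mon_wt m = card (mon_supp m)"

definition mon_deg :: "monom \<Rightarrow> nat" where
  "mon_deg m = (\<Sum>j\<in>mon_supp m. Poly_Mapping.lookup m j)"

definition Supp :: "'k::comm_ring_1 mvpoly \<Rightarrow> nat set" where
  "Supp P = (\<Union>m\<in>Mon P. mon_supp m)"

definition wt :: "'k::comm_ring_1 mvpoly \<Rightarrow> nat" where
  "wt P = card (Supp P)"

text \<open>The zero polynomial gets total degree \<open>0\<close>.\<close>

definition total_deg :: "'k::comm_ring_1 mvpoly \<Rightarrow> nat" where
  "total_deg P = Max (insert 0 (mon_deg ` Mon P))"

definition hom_comp :: "nat \<Rightarrow> 'k::comm_ring_1 mvpoly \<Rightarrow> 'k mvpoly" where
  "hom_comp h P =
     (\<Sum>m\<in>{m \<in> Mon P. mon_deg m = h}. Poly_Mapping.single m (Poly_Mapping.lookup P m))"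

text \<open>The type \<^typ>\<open>'k mvpoly\<close> has a variable for every natural number; the ring
  \<open>K[X\<^sub>1, \<dots>, X\<^sub>n]\<close> consists of those polynomials in which only the variables with
  index in \<open>{1..n}\<close> occur.\<close>

definition poly_ring :: "nat \<Rightarrow> 'k::comm_ring_1 mvpoly ring" where
  "poly_ring n =
     \<lparr>carrier = {P. Supp P \<subseteq> {1..n}}, monoid.mult = (*), one = 1, zero = 0, add = (+)\<rparr>"

lemma keys_add_mon: "Poly_Mapping.keys (a + b :: monom) = Poly_Mapping.keys a \<union> Poly_Mapping.keys b"
  by (auto simp: in_keys_iff lookup_add)

lemma Supp_add: "Supp (P + Q) \<subseteq> Supp P \<union> Supp Q"
  using Poly_Mapping.keys_add[of P Q] unfolding Supp_def Mon_def by blast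

lemma Supp_mult: "Supp (P * Q) \<subseteq> Supp P \<union> Supp Q"
  using keys_mult[of P Q] unfolding Supp_def Mon_def mon_supp_def
  by (fastforce simp: keys_add_mon)

lemma Supp_uminus: "Supp (- P) = Supp P"
  by (simp add: Supp_def Mon_def)

lemma cring_poly_ring: "cring (poly_ring n :: 'k::comm_ring_1 mvpoly ring)"
proof (rule cringI)
  show "abelian_group (poly_ring n :: 'k mvpoly ring)"
  proof (rule abelian_groupI)
    fix P :: "'k mvpoly"
    assume "P \<in> carrier (poly_ring n)"
    then have "- P \<in> carrier (poly_ring n)"
      by (simp add: poly_ring_def Supp_uminus)
    then show "\<exists>Q\<in>carrier (poly_ring n). Q \<oplus>\<^bsub>poly_ring n\<^esub> P = \<zero>\<^bsub>poly_ring n\<^esub>"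
      by (intro bexI[of _ "- P"]) (simp_all add: poly_ring_def)
  qed (use Supp_add in \<open>fastforce simp: poly_ring_def add.assoc add.commute Supp_def Mon_def\<close>)+
next
  show "Group.comm_monoid (poly_ring n :: 'k mvpoly ring)"
    by (rule comm_monoidI)
      (use Supp_mult in \<open>fastforce simp: poly_ring_def mult.assoc mult.commute Supp_def Mon_def
        mon_supp_def\<close>)+
qed (auto simp: poly_ring_def distrib_right)

text \<open>The image of \<open>P\<close> under the substitution \<open>Var i \<mapsto> Var (\<sigma> i)\<close>.\<close>

definition perm_poly :: "(nat \<Rightarrow> nat) \<Rightarrow> 'k::comm_ring_1 mvpoly \<Rightarrow> 'k mvpoly" where
  "perm_poly \<sigma> P =
     (\<Sum>m\<in>Mon P. Const (Poly_Mapping.lookup P m) *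
        (\<Prod>i\<in>mon_supp m. Var (\<sigma> i) ^ Poly_Mapping.lookup m i))"

definition symmetric_ideal :: "nat \<Rightarrow> 'k::comm_ring_1 mvpoly set \<Rightarrow> bool" where
  "symmetric_ideal n I \<longleftrightarrow>
     ideal I (poly_ring n) \<and> (\<forall>P\<in>I. \<forall>\<sigma>. \<sigma> permutes {1..n} \<longrightarrow> perm_poly \<sigma> P \<in> I)"

text \<open>A partition is the list of its parts: part number \<open>j\<close> is \<open>lam ! (j - 1)\<close>.\<close>

definition is_partition :: "nat list \<Rightarrow> nat \<Rightarrow> bool" where
  "is_partition lam n \<longleftrightarrow> sorted_wrt (\<ge>) lam \<and> (\<forall>x\<in>set lam. 0 < x) \<and> sum_list lam = n"

definition dual_partition :: "nat list \<Rightarrow> nat list" where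
  "dual_partition lam =
     map (\<lambda>i. card {j. j < length lam \<and> i \<le> lam ! j}) [1..<Suc (Max (insert 0 (set lam)))]"

definition dominated :: "nat list \<Rightarrow> nat list \<Rightarrow> bool" where
  "dominated lam \<mu> \<longleftrightarrow>
     (\<forall>i. 1 \<le> i \<and> i \<le> min (length lam) (length \<mu>) \<longrightarrow> sum_list (take i lam) \<le> sum_list (take i \<mu>))"

definition mon_exponents :: "monom \<Rightarrow> nat list" where
  "mon_exponents m =
     rev (sort (map (Poly_Mapping.lookup m) (sorted_list_of_set (mon_supp m))))"

definition mu :: "nat \<Rightarrow> monom \<Rightarrow> nat list" where
  "mu n m = map Suc (mon_exponents m) @ replicate (n - mon_deg m - mon_wt m) 1"

text \<open>A tableau is the list of its rows.\<close>

definition is_tableau :: "nat \<Rightarrow> nat list \<Rightarrow> nat list list \<Rightarrow> bool" where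
  "is_tableau n lam T \<longleftrightarrow>
     map length T = lam \<and> distinct (concat T) \<and> set (concat T) = {1..n}"

definition Delta :: "nat list \<Rightarrow> 'k::comm_ring_1 mvpoly" where
  "Delta S = (\<Prod>(j, k)\<in>{(j, k). j < k \<and> k < length S}. Var (S ! j) - Var (S ! k))"

text \<open>The rows of a tableau have weakly decreasing lengths, so the entries of the list
  \<^term>\<open>List.transpose T\<close> are the columns of \<open>T\<close>, each read from top to bottom.\<close>

definition specht :: "nat list list \<Rightarrow> 'k::comm_ring_1 mvpoly" where
  "specht T = prod_list (map Delta (List.transpose T))"

definition specht_ideal :: "nat \<Rightarrow> nat list \<Rightarrow> 'k::comm_ring_1 mvpoly set" where
  "specht_ideal n lam = Idl\<^bsub>poly_ring n\<^esub> {specht T | T. is_tableau n lam T}"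

end

theory Submission
  imports Defs "Jordan_Normal_Form.Determinant"
begin

text \<open>
  A Specht polynomial is a product of Vandermonde products, one for each column of the tableau,
  and only the lengths of the columns matter for the argument. The shape with column
  lengths \<open>mu n m\<close> is reached directly. The Vandermonde product of a column is the antisymmetrisation of
  the monomial with exponents \<open>a - 1, \<dots>, 1, 0\<close> over the column. So one moves the variables of the
  leading form of \<open>P\<close> to the heads of columns, multiplies by a monomial that supplies the smaller
  exponents in the remaining boxes, and antisymmetrises over all columns, which a symmetric ideal
  permits. A monomial whose exponents repeat in a column disappears; comparing degrees shows that every
  monomial except \<open>m\<close> does (\<open>mu_columns_in_ideal\<close>). What remains is the Specht polynomial times the
  coefficient of \<open>m\<close>. Since determinants with two equal rows vanish in every characteristic,
  so do these antisymmetrisations.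

  The other shapes follow by moving boxes. If one column is shorter than another one, the Vandermonde
  products of the two columns lie in the ideal generated by those of all pairs in which one entry
  of the longer column has been moved to the shorter one. This is Lagrange interpolation: a signed
  sum of powers of the entries, weighted by the Vandermonde products of the others, vanishes in
  low degree and gives the full Vandermonde product in the critical degree, one less than the
  length of the longer column (\<open>vandermonde_box_move\<close>). Column lengths that dominate
  \<open>mu n m\<close> are connected with it by such moves
  (\<open>dominating_columns_in_ideal\<close>), and duality turns the hypothesis on row lengths into this
  condition on column lengths (\<open>dominated_dual_partition_prefix_sums\<close>).
\<close>

section \<open>Alternants and Vandermonde products\<close>

text \<open>The generalised Vandermonde determinant. By the Leibniz formula it is the antisymmetrisation, over
  all permutations of \<open>xs\<close>, of the monomial with exponents \<open>es\<close>.\<close>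

definition alternant :: "'a::comm_ring_1 list \<Rightarrow> nat list \<Rightarrow> 'a" where
  "alternant xs es = det (mat (length xs) (length xs) (\<lambda>(i, j). xs ! j ^ (es ! i)))"

fun vandermonde :: "'a::comm_ring_1 list \<Rightarrow> 'a" where
  "vandermonde [] = 1"
| "vandermonde (x # xs) = (\<Prod>t\<leftarrow>xs. x - t) * vandermonde xs"

definition delete_nth :: "nat \<Rightarrow> 'a list \<Rightarrow> 'a list" where
  "delete_nth k xs = take k xs @ drop (Suc k) xs"

lemma length_delete_nth: "k < length xs \<Longrightarrow> length (delete_nth k xs) = length xs - 1"
  by (simp add: delete_nth_def)

lemma nth_delete_nth:
  "k < length xs \<Longrightarrow> j < length xs - 1 \<Longrightarrow> delete_nth k xs ! j = xs ! (if j < k then j else Suc j)"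
  by (auto simp: delete_nth_def nth_append min_def)

lemma delete_nth_0 [simp]: "delete_nth 0 (x # xs) = xs"
  by (simp add: delete_nth_def)

lemma delete_nth_Suc [simp]: "delete_nth (Suc k) (x # xs) = x # delete_nth k xs"
  by (simp add: delete_nth_def)

lemma prod_list_delete_nth:
  fixes f :: "'a \<Rightarrow> 'b::comm_monoid_mult"
  assumes "k < length xs"
  shows "f (xs ! k) * prod_list (map f (delete_nth k xs)) = prod_list (map f xs)"
proof -
  have "prod_list (map f xs) = prod_list (map f (take k xs @ xs ! k # drop (Suc k) xs))"
    using assms by (simp add: id_take_nth_drop[symmetric])
  then show ?thesis
    by (simp add: delete_nth_def mult_ac)
qed

lemma mset_delete_nth: "k < length xs \<Longrightarrow> add_mset (xs ! k) (mset (delete_nth k xs)) = mset xs"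
  unfolding delete_nth_def
  by (metis id_take_nth_drop mset.simps(2) mset_append union_mset_add_mset_right)

lemma alternant_repeated_exponent:
  assumes "length es = length xs" "\<not> distinct es"
  shows "alternant xs es = 0"
proof -
  obtain i j where ij: "i < length es" "j < length es" "i \<noteq> j" "es ! i = es ! j"
    using assms(2) by (auto simp: distinct_conv_nth)
  show ?thesis
    unfolding alternant_def
    by (rule det_identical_rows[of _ "length xs" i j]) (use ij assms(1) in \<open>auto intro!: eq_vecI\<close>)
qed

text \<open>Expansion of the determinant along its first row, the only one that involves \<open>e\<close>.\<close>

lemma alternant_laplace:
  assumes "xs \<noteq> []"
  shows "alternant xs (e # es) =
    (\<Sum>k<length xs. (-1) ^ k * xs ! k ^ e * alternant (delete_nth k xs) es)"
proof -
  let ?A = "mat (length xs) (length xs) (\<lambda>(i, j). xs ! j ^ ((e # es) ! i))"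
  have "alternant xs (e # es) = (\<Sum>k<length xs. ?A $$ (0, k) * cofactor ?A 0 k)"
    unfolding alternant_def by (rule laplace_expansion_row) (use assms in auto)
  also have "\<dots> = (\<Sum>k<length xs. (-1) ^ k * xs ! k ^ e * alternant (delete_nth k xs) es)"
  proof (rule sum.cong)
    fix k assume k: "k \<in> {..<length xs}"
    have "mat_delete ?A 0 k = mat (length xs - 1) (length xs - 1) (\<lambda>(i, j). delete_nth k xs ! j ^ (es ! i))"
      using k by (intro eq_matI) (auto simp: mat_delete_def nth_delete_nth)
    then show "?A $$ (0, k) * cofactor ?A 0 k =
        (-1) ^ k * xs ! k ^ e * alternant (delete_nth k xs) es"
      using k assms by (simp add: alternant_def cofactor_def length_delete_nth)
  qed simp
  finally show ?thesis .
qed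

text \<open>Subtract \<open>x\<close> times the sum with exponent \<open>e\<close> from the one with exponent \<open>e + 1\<close>: the summand of
  \<open>x\<close> itself cancels, and in the summand of another entry \<open>y\<close> the extra factor \<open>y - x\<close> completes
  the Vandermonde product of \<open>x\<close> with the remaining entries to the product over all of \<open>ys\<close>.\<close>

lemma signed_power_sum_Cons:
  fixes x :: "'a::comm_ring_1"
  shows "(\<Sum>k<length (x # ys). (-1) ^ k * (x # ys) ! k ^ Suc e * vandermonde (delete_nth k (x # ys))) =
    x * (\<Sum>k<length (x # ys). (-1) ^ k * (x # ys) ! k ^ e * vandermonde (delete_nth k (x # ys))) +
    (\<Prod>t\<leftarrow>ys. x - t) * (\<Sum>k<length ys. (-1) ^ k * ys ! k ^ e * vandermonde (delete_nth k ys))"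
proof -
  let ?f = "\<lambda>e k. (-1) ^ Suc k * ys ! k ^ e * vandermonde (x # delete_nth k ys)"
  let ?g = "\<lambda>k. (-1) ^ k * ys ! k ^ e * vandermonde (delete_nth k ys)"
  have "?f (Suc e) k = x * ?f e k + (\<Prod>t\<leftarrow>ys. x - t) * ?g k" if "k < length ys" for k
    using that by (simp add: prod_list_delete_nth[of k ys "\<lambda>t. x - t", symmetric] algebra_simps)
  then have "(\<Sum>k<length ys. ?f (Suc e) k) =
      x * (\<Sum>k<length ys. ?f e k) + (\<Prod>t\<leftarrow>ys. x - t) * (\<Sum>k<length ys. ?g k)"
    by (simp only: sum_distrib_left sum.distrib[symmetric], intro sum.cong) auto
  moreover have "(\<Sum>k<length (x # ys). (-1) ^ k * (x # ys) ! k ^ e * vandermonde (delete_nth k (x # ys))) =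
      x ^ e * vandermonde ys + (\<Sum>k<length ys. ?f e k)" for e
    by (simp only: length_Cons sum.lessThan_Suc_shift) simp
  ultimately show ?thesis
    by (simp only: distrib_left) (simp add: algebra_simps)
qed

text \<open>The classical Vandermonde determinant. By Laplace expansion and induction, the alternant with
  exponents \<open>e, m, \<dots>, 0\<close> is the signed power sum with exponent \<open>e\<close>. The recursion above
  expresses the case \<open>e = m + 1\<close> through the case \<open>e = m\<close>, which vanishes because two exponents
  coincide, and through a shorter list, which produces the missing factors.\<close>

lemma alternant_staircase:
  "alternant xs (rev [0..<length xs]) = vandermonde xs"
proof (induction "length xs" arbitrary: xs rule: less_induct)
  case less
  have laplace: "alternant zs (e # rev [0..<length zs - 1]) =
      (\<Sum>k<length zs. (-1) ^ k * zs ! k ^ e * vandermonde (delete_nth k zs))"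
    if "zs \<noteq> []" "length zs \<le> length xs" for zs :: "'a list" and e
  proof -
    have "alternant (delete_nth k zs) (rev [0..<length zs - 1]) = vandermonde (delete_nth k zs)"
      if "k < length zs" for k
      using less[of "delete_nth k zs"] that \<open>zs \<noteq> []\<close> \<open>length zs \<le> length xs\<close>
      by (simp add: length_delete_nth)
    then show ?thesis
      using alternant_laplace[OF \<open>zs \<noteq> []\<close>, of e "rev [0..<length zs - 1]"] by simp
  qed
  show ?case
  proof (cases xs)
    case Nil
    then show ?thesis by (simp add: alternant_def)
  next
    case (Cons x ys)
    show ?thesis
    proof (cases "length ys")
      case 0
      with Cons laplace[of xs 0] show ?thesis by simp
    next
      case (Suc m)
      let ?F = "\<lambda>e zs. \<Sum>k<length zs. (-1) ^ k * zs ! k ^ e * vandermonde (delete_nth k zs)"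
      have "alternant xs (rev [0..<length xs]) = ?F (Suc m) (x # ys)"
        using laplace[of xs "Suc m"] Cons Suc by simp
      also have "\<dots> = x * ?F m (x # ys) + (\<Prod>t\<leftarrow>ys. x - t) * ?F m ys"
        by (rule signed_power_sum_Cons)
      also have "?F m (x # ys) = alternant xs (m # rev [0..<Suc m])"
        using laplace[of xs m] Cons Suc by simp
      also have "\<dots> = 0"
        by (rule alternant_repeated_exponent) (use Cons Suc in auto)
      also have "?F m ys = alternant ys (rev [0..<length ys])"
        using laplace[of ys m] Cons Suc by force
      also have "\<dots> = vandermonde ys"
        using less[of ys] Cons by simp
      finally show ?thesis using Cons by simp
    qed
  qed
qed

text \<open>In Lagrange's form: the divided difference of \<open>x\<^sup>e\<close> at the points \<open>xs\<close>, multiplied by the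
  Vandermonde product, vanishes in low degree and is that product in the critical degree.\<close>

lemma signed_power_sum:
  assumes "e < length xs"
  shows "(\<Sum>k<length xs. (-1) ^ k * xs ! k ^ e * vandermonde (delete_nth k xs)) =
    (if Suc e = length xs then vandermonde xs else 0)"
proof -
  have "alternant (delete_nth k xs) (rev [0..<length xs - 1]) = vandermonde (delete_nth k xs)"
    if "k < length xs" for k
    using alternant_staircase[of "delete_nth k xs"] that by (simp add: length_delete_nth)
  then have "(\<Sum>k<length xs. (-1) ^ k * xs ! k ^ e * vandermonde (delete_nth k xs)) =
      alternant xs (e # rev [0..<length xs - 1])"
    using assms by (subst alternant_laplace) auto
  also have "\<dots> = (if Suc e = length xs then vandermonde xs else 0)"
  proof (cases "Suc e = length xs")
    case True
    then have "e # rev [0..<length xs - 1] = rev [0..<length xs]"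
      by (metis diff_Suc_1 rev.simps(2) rev_append rev_rev_ident rev_singleton_conv append_Cons append_Nil upt_Suc_append zero_le)
    then show ?thesis using True alternant_staircase[of xs] by simp
  next
    case False
    then show ?thesis using assms by (simp add: alternant_repeated_exponent)
  qed
  finally show ?thesis .
qed

text \<open>The identity behind moving one box: transfer each entry \<open>xs ! k\<close> in turn from the column \<open>xs\<close>
  to the column \<open>ys\<close>. As a function of the moved entry the new factor is monic of degree
  \<open>length ys\<close>, so only its leading term survives in the signed sum, and only if \<open>e\<close> lifts it
  to the critical degree.\<close>

lemma vandermonde_box_move:
  assumes "e + length ys < length xs"
  shows "(\<Sum>k<length xs. (-1) ^ k * xs ! k ^ e *
      ((\<Prod>t\<leftarrow>ys. xs ! k - t) * vandermonde (delete_nth k xs))) =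
    (if Suc (e + length ys) = length xs then vandermonde xs else 0)"
  using assms
proof (induction ys arbitrary: e)
  case Nil
  then show ?case using signed_power_sum[of e xs] by (simp add: mult_ac)
next
  case (Cons s ys)
  let ?H = "\<lambda>e ys. \<Sum>k<length xs. (-1) ^ k * xs ! k ^ e *
      ((\<Prod>t\<leftarrow>ys. xs ! k - t) * vandermonde (delete_nth k xs))"
  have "?H e (s # ys) = ?H (Suc e) ys - s * ?H e ys"
    by (simp add: sum_distrib_left sum_subtractf[symmetric] algebra_simps)
  then show ?case
    using Cons.IH[of e] Cons.IH[of "Suc e"] Cons.prems by simp
qed

section \<open>Permuting variables is a ring homomorphism\<close>

lemma poly_eq_sum_monomials:
  "(P :: 'k::comm_ring_1 mvpoly) = (\<Sum>m\<in>Mon P. Poly_Mapping.single m (Poly_Mapping.lookup P m))"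
  by (rule poly_mapping_eqI)
    (auto simp: lookup_sum lookup_single Mon_def when_def in_keys_iff)

text \<open>The defining sums and products run over supports. Extending them to larger finite index sets
  makes them comparable for different polynomials and monomials.\<close>

lemma perm_poly_superset:
  assumes "finite S" "Mon P \<subseteq> S"
  shows "perm_poly \<sigma> P = (\<Sum>m\<in>S. Const (Poly_Mapping.lookup P m) *
        (\<Prod>i\<in>mon_supp m. Var (\<sigma> i) ^ Poly_Mapping.lookup m i))"
  unfolding perm_poly_def
  by (rule sum.mono_neutral_left) (use assms in \<open>auto simp: Mon_def in_keys_iff Const_def\<close>)

lemma perm_monomial_superset:
  assumes "finite S" "mon_supp m \<subseteq> S"
  shows "(\<Prod>i\<in>mon_supp m. Var (\<sigma> i) ^ Poly_Mapping.lookup m i) =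
    (\<Prod>i\<in>S. Var (\<sigma> i) ^ Poly_Mapping.lookup m i :: 'k::comm_ring_1 mvpoly)"
  by (rule prod.mono_neutral_left) (use assms in \<open>auto simp: mon_supp_def in_keys_iff\<close>)

lemma perm_poly_single:
  "perm_poly \<sigma> (Poly_Mapping.single m c) =
    Const c * (\<Prod>i\<in>mon_supp m. Var (\<sigma> i) ^ Poly_Mapping.lookup m i)"
  by (subst perm_poly_superset[of "{m}"]) (auto simp: Mon_def)

lemma perm_poly_add: "perm_poly \<sigma> (P + Q) = perm_poly \<sigma> P + perm_poly \<sigma> Q"
proof -
  let ?S = "Mon P \<union> Mon Q"
  have fin: "finite ?S" by (simp add: Mon_def)
  have sub: "Mon (P + Q) \<subseteq> ?S" using Poly_Mapping.keys_add[of P Q] by (simp add: Mon_def)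
  show ?thesis
    by (simp add: perm_poly_superset[OF fin sub] perm_poly_superset[OF fin, of P] perm_poly_superset[OF fin, of Q]
        lookup_add Const_def single_add distrib_right sum.distrib)
qed

lemma perm_poly_zero: "perm_poly \<sigma> 0 = 0"
  by (simp add: perm_poly_def Mon_def)

lemma perm_poly_sum: "perm_poly \<sigma> (sum f S) = (\<Sum>s\<in>S. perm_poly \<sigma> (f s))"
  by (induction S rule: infinite_finite_induct) (simp_all add: perm_poly_zero perm_poly_add)

lemma Const_mult: "Const (a * b) = Const a * Const b"
  by (simp add: Const_def mult_single)

lemma perm_poly_mult: "perm_poly \<sigma> (P * Q) = perm_poly \<sigma> P * perm_poly \<sigma> Q"
proof -
  have single: "perm_poly \<sigma> (Poly_Mapping.single a b * Poly_Mapping.single c e) =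
      perm_poly \<sigma> (Poly_Mapping.single a b) * perm_poly \<sigma> (Poly_Mapping.single c e)"
    for a c :: monom and b e :: 'a
  proof -
    let ?S = "mon_supp a \<union> mon_supp c"
    have fin: "finite ?S" by (simp add: mon_supp_def)
    have sub: "mon_supp (a + c) \<subseteq> ?S" by (simp add: mon_supp_def keys_add_mon)
    show ?thesis
      unfolding mult_single perm_poly_single perm_monomial_superset[OF fin sub]
        perm_monomial_superset[OF fin, of a, simplified] perm_monomial_superset[OF fin, of c, simplified]
      by (simp add: lookup_add power_add prod.distrib Const_mult mult_ac)
  qed
  show ?thesis
    by (subst poly_eq_sum_monomials[of P], subst poly_eq_sum_monomials[of Q],
        subst (2) poly_eq_sum_monomials[of P], subst (2) poly_eq_sum_monomials[of Q])
      (simp add: sum_product perm_poly_sum single)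
qed

lemma perm_poly_Var [simp]: "perm_poly \<sigma> (Var i) = Var (\<sigma> i)"
  by (simp add: Var_def[of i] perm_poly_single mon_supp_def Const_def)

lemma perm_poly_Const [simp]: "perm_poly \<sigma> (Const c) = Const c"
  using perm_poly_single[of \<sigma> 0 c] by (simp add: Const_def mon_supp_def)

interpretation perm_poly: comm_ring_hom "perm_poly \<sigma> :: 'k::comm_ring_1 mvpoly \<Rightarrow> 'k mvpoly" for \<sigma>
proof
  show "perm_poly \<sigma> 1 = 1"
    using perm_poly_Const[of \<sigma> 1] by (simp add: Const_def)
qed (simp_all add: perm_poly_add perm_poly_mult perm_poly_zero)

section \<open>Symmetric ideals\<close>

lemma symmetric_ideal_subset:
  assumes "symmetric_ideal n I" "P \<in> I"
  shows "Supp P \<subseteq> {1..n}"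
  using assms ideal.Icarr[of I "poly_ring n" P] by (simp add: symmetric_ideal_def poly_ring_def)

lemma symmetric_ideal_zero:
  assumes "symmetric_ideal n I"
  shows "0 \<in> I"
proof -
  interpret ideal I "poly_ring n" using assms by (simp add: symmetric_ideal_def)
  show ?thesis using additive_subgroup.zero_closed[OF is_additive_subgroup] by (simp add: poly_ring_def)
qed

lemma symmetric_ideal_add:
  assumes "symmetric_ideal n I" "P \<in> I" "Q \<in> I"
  shows "P + Q \<in> I"
proof -
  interpret ideal I "poly_ring n" using assms by (simp add: symmetric_ideal_def)
  show ?thesis using additive_subgroup.a_closed[OF is_additive_subgroup assms(2,3)] by (simp add: poly_ring_def)
qed

lemma symmetric_ideal_mult:
  assumes "symmetric_ideal n I" "P \<in> I" "Supp R \<subseteq> {1..n}"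
  shows "R * P \<in> I"
proof -
  interpret ideal I "poly_ring n" using assms by (simp add: symmetric_ideal_def)
  show ?thesis using I_l_closed[OF assms(2), of R] assms(3) by (simp add: poly_ring_def)
qed

lemma symmetric_ideal_perm:
  "symmetric_ideal n I \<Longrightarrow> P \<in> I \<Longrightarrow> \<sigma> permutes {1..n} \<Longrightarrow> perm_poly \<sigma> P \<in> I"
  by (simp add: symmetric_ideal_def)

lemma symmetric_ideal_sum:
  assumes "symmetric_ideal n I" "\<And>s. s \<in> S \<Longrightarrow> f s \<in> I"
  shows "sum f S \<in> I"
  using assms(2)
  by (induction S rule: infinite_finite_induct)
    (auto intro: symmetric_ideal_zero[OF assms(1)] symmetric_ideal_add[OF assms(1)])

lemma Supp_Const [simp]: "Supp (Const a) = {}"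
  by (simp add: Supp_def Mon_def mon_supp_def Const_def)

lemma Supp_of_int [simp]: "Supp (of_int z :: 'k::comm_ring_1 mvpoly) = {}"
  using Supp_Const[of "of_int z :: 'k"] by (simp add: Const_def)

lemma Supp_one [simp]: "Supp 1 = {}"
  using Supp_of_int[of 1] by simp

lemma Supp_Var: "Supp (Var i) \<subseteq> {i}"
  by (auto simp: Supp_def Mon_def mon_supp_def Var_def split: if_splits)

lemma Supp_power: "Supp (P ^ k) \<subseteq> Supp P"
proof (induction k)
  case (Suc k)
  then show ?case using Supp_mult[of P "P ^ k"] by auto
qed simp

lemma Supp_prod: "(\<And>s. s \<in> S \<Longrightarrow> Supp (f s) \<subseteq> A) \<Longrightarrow> Supp (prod f S) \<subseteq> A"
proof (induction S rule: infinite_finite_induct)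
  case (insert s S)
  then show ?case using Supp_mult[of "f s" "prod f S"] by fastforce
qed auto

section \<open>Splitting the variables into columns\<close>

text \<open>Up to \<open>N\<close>, the lists \<open>c i\<close> split the variables \<open>1, \<dots>, n\<close> into columns. Columns may be empty,
  so that systems with different numbers of columns have the same index set, and the lengths need
  not decrease, so that moving a box never requires reordering.\<close>

definition column_system :: "nat \<Rightarrow> nat \<Rightarrow> (nat \<Rightarrow> nat list) \<Rightarrow> bool" where
  "column_system n N c \<longleftrightarrow> (\<Sum>i<N. mset (c i)) = mset_set {1..n}"

lemma column_system_prod:
  assumes "column_system n N c"
  shows "(\<Prod>v\<in>{1..n}. f v) = (\<Prod>i<N. \<Prod>v\<leftarrow>c i. f v)"
proof -
  have "prod_mset (image_mset f (\<Sum>i<N. mset (c i))) = (\<Prod>i<N. \<Prod>v\<leftarrow>c i. f v)"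
    by (induction N) (simp_all add: mult.commute prod_mset_prod_list flip: mset_map)
  then show ?thesis
    using assms by (simp add: column_system_def prod_unfold_prod_mset)
qed

lemma column_system_sum:
  assumes "column_system n N c"
  shows "(\<Sum>v\<in>{1..n}. f v) = (\<Sum>i<N. \<Sum>v\<leftarrow>c i. f v)"
proof -
  have "sum_mset (image_mset f (\<Sum>i<N. mset (c i))) = (\<Sum>i<N. \<Sum>v\<leftarrow>c i. f v)"
    by (induction N) (simp_all add: add.commute sum_mset_sum_list flip: mset_map)
  then show ?thesis
    using assms by (simp add: column_system_def sum_unfold_sum_mset)
qed

lemma column_system_concat:
  assumes "column_system n N c"
  shows "distinct (concat (map c [0..<N]))" "set (concat (map c [0..<N])) = {1..n}"
proof -
  have "mset (concat (map c [0..<N])) = (\<Sum>i<N. mset (c i))"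
    by (induction N) (simp_all add: add.commute)
  then have *: "mset (concat (map c [0..<N])) = mset [1..<Suc n]"
    using assms by (simp add: column_system_def mset_upt atLeastLessThanSuc_atLeastAtMost del: upt_Suc)
  show "distinct (concat (map c [0..<N]))"
    using mset_eq_imp_distinct_iff[OF *] by simp
  show "set (concat (map c [0..<N])) = {1..n}"
    using mset_eq_setD[OF *] by (simp add: atLeastLessThanSuc_atLeastAtMost del: upt_Suc)
qed

lemma column_system_subset: "column_system n N c \<Longrightarrow> i < N \<Longrightarrow> set (c i) \<subseteq> {1..n}"
  using column_system_concat(2)[of n N c] by auto

lemma column_system_distinct: "column_system n N c \<Longrightarrow> i < N \<Longrightarrow> distinct (c i)"
  using column_system_concat(1)[of n N c] by (force simp: distinct_concat_iff)

lemma column_system_disjoint: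
  assumes "column_system n N c" "i < N" "j < N" "i \<noteq> j"
  shows "set (c i) \<inter> set (c j) = {}"
proof (rule ccontr)
  assume "set (c i) \<inter> set (c j) \<noteq> {}"
  then obtain v where v: "v \<in> set (c i)" "v \<in> set (c j)" by blast
  have "count (mset (c i)) v + count (mset (c j)) v = (\<Sum>k\<in>{i, j}. count (mset (c k)) v)"
    using assms(4) by simp
  also have "\<dots> \<le> (\<Sum>k<N. count (mset (c k)) v)"
    by (rule sum_mono2) (use assms in auto)
  also have "\<dots> = count (mset_set {1..n}) v"
    using assms(1) by (simp add: column_system_def flip: count_sum)
  also have "\<dots> \<le> 1"
    by (simp add: count_mset_set')
  finally show False
    using v by (simp flip: count_greater_zero_iff set_mset_mset)
qed

section \<open>Antisymmetrisation over columns\<close>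

definition column_monomial :: "nat list \<Rightarrow> nat list \<Rightarrow> 'k::comm_ring_1 mvpoly" where
  "column_monomial C es = (\<Prod>k<length C. Var (C ! k) ^ (es ! k))"

lemma perm_poly_alternant:
  "perm_poly \<sigma> (alternant (map Var C) es :: 'k::comm_ring_1 mvpoly) = alternant (map (\<lambda>v. Var (\<sigma> v)) C) es"
proof -
  have "map_mat (perm_poly \<sigma>) (mat (length C) (length C) (\<lambda>(i, j). map Var C ! j ^ (es ! i))) =
      (mat (length C) (length C) (\<lambda>(i, j). map (\<lambda>v. Var (\<sigma> v)) C ! j ^ (es ! i)) :: 'k mvpoly mat)"
    by (rule eq_matI) (auto simp: perm_poly.hom_power)
  then show ?thesis
    by (simp add: alternant_def flip: perm_poly.hom_det)
qed

text \<open>Applying all permutations of the variables in \<open>C\<close> to an element of the ideal and adding the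
  results with signs leaves the cofactors \<open>F t\<close> alone and turns each monomial in the variables of
  \<open>C\<close> into an alternant, by the Leibniz formula.\<close>

lemma antisymmetrise_column:
  fixes I :: "'k::comm_ring_1 mvpoly set"
  assumes I: "symmetric_ideal n I" and C: "distinct C" "set C \<subseteq> {1..n}"
    and fixed: "\<And>\<sigma> t. t \<in> S \<Longrightarrow> (\<And>v. v \<notin> set C \<Longrightarrow> \<sigma> v = v) \<Longrightarrow> perm_poly \<sigma> (F t) = F t"
    and mem: "(\<Sum>t\<in>S. F t * column_monomial C (es t)) \<in> I"
  shows "(\<Sum>t\<in>S. F t * alternant (map Var C) (es t)) \<in> I"
proof -
  let ?a = "length C"
  let ?Q = "\<Sum>t\<in>S. F t * column_monomial C (es t)"
  \<comment> \<open>\<open>\<tau> p\<close> is the permutation \<open>p\<close> of positions, as a permutation of the variables in \<open>C\<close>.\<close>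
  define \<tau> where "\<tau> p = map_permutation {0..<?a} (\<lambda>k. C ! k) p" for p
  have inj: "inj_on (\<lambda>k. C ! k) {0..<?a}"
    using C(1) by (auto simp: inj_on_def nth_eq_iff_index_eq)
  have \<tau>_perm: "\<tau> p permutes set C" if "p permutes {0..<?a}" for p
    unfolding \<tau>_def
    by (rule map_permutation_permutes[OF _ that]) (use inj in \<open>auto simp: bij_betw_def set_conv_nth\<close>)
  have \<tau>_nth: "\<tau> p (C ! k) = C ! p k" if "k < ?a" for p k
    unfolding \<tau>_def by (rule map_permutation_apply[OF inj]) (use that in auto)
  have image: "perm_poly (\<tau> p) ?Q = (\<Sum>t\<in>S. F t * (\<Prod>k = 0..<?a. Var (C ! p k) ^ (es t ! k)))"
    if p: "p permutes {0..<?a}" for p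
  proof -
    have "perm_poly (\<tau> p) (F t) = F t" if "t \<in> S" for t
      using fixed[OF that, of "\<tau> p"] permutes_not_in[OF \<tau>_perm[OF p]] by blast
    then show ?thesis
      by (simp add: perm_poly.hom_sum perm_poly.hom_mult perm_poly.hom_prod perm_poly.hom_power
          column_monomial_def \<tau>_nth atLeast0LessThan)
  qed
  have alt: "alternant (map Var C) e = (\<Sum>p | p permutes {0..<?a}.
      signof p * (\<Prod>k = 0..<?a. Var (C ! p k) ^ (e ! k)) :: 'k mvpoly)" for e
  proof -
    have "(\<Prod>k = 0..<?a. mat ?a ?a (\<lambda>(i, j). map Var C ! j ^ (e ! i)) $$ (k, p k)) =
        (\<Prod>k = 0..<?a. Var (C ! p k) ^ (e ! k) :: 'k mvpoly)" if "p permutes {0..<?a}" for p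
    proof (rule prod.cong)
      fix k assume "k \<in> {0..<?a}"
      then show "mat ?a ?a (\<lambda>(i, j). map Var C ! j ^ (e ! i)) $$ (k, p k) = Var (C ! p k) ^ (e ! k)"
        using permutes_in_image[OF that, of k] by simp
    qed simp
    then show ?thesis
      unfolding alternant_def by (subst det_def'[of _ ?a]) (auto intro!: sum.cong)
  qed
  have "(\<Sum>t\<in>S. F t * alternant (map Var C) (es t)) =
      (\<Sum>p | p permutes {0..<?a}. signof p * perm_poly (\<tau> p) ?Q)"
    unfolding alt sum_distrib_left
    by (subst sum.swap) (auto intro!: sum.cong simp: image sum_distrib_left mult_ac)
  also have "\<dots> \<in> I"
  proof (rule symmetric_ideal_sum[OF I], elim CollectE)
    fix p assume "p permutes {0..<?a}"
    then have "\<tau> p permutes {1..n}"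
      using \<tau>_perm permutes_subset C(2) by blast
    then show "signof p * perm_poly (\<tau> p) ?Q \<in> I"
      by (intro symmetric_ideal_mult[OF I] symmetric_ideal_perm[OF I] mem) simp_all
  qed
  finally show ?thesis .
qed

text \<open>One column after the other: the columns are disjoint, so antisymmetrising over one of them moves
  neither the alternants obtained before nor the monomials of the columns still to come.\<close>

lemma antisymmetrise_columns:
  fixes I :: "'k::comm_ring_1 mvpoly set"
  assumes I: "symmetric_ideal n I" and c: "column_system n N c"
    and mem: "(\<Sum>t\<in>S. Const (a t) * (\<Prod>i<N. column_monomial (c i) (es t i))) \<in> I"
  shows "(\<Sum>t\<in>S. Const (a t) * (\<Prod>i<N. alternant (map Var (c i)) (es t i))) \<in> I"
proof -
  have "(\<Sum>t\<in>S. Const (a t) * ((\<Prod>i<K. alternant (map Var (c i)) (es t i)) *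
      (\<Prod>i\<in>{K..<N}. column_monomial (c i) (es t i)))) \<in> I" if "K \<le> N" for K
    using that
  proof (induction K)
    case 0
    then show ?case using mem by (simp add: atLeast0LessThan)
  next
    case (Suc K)
    define F where "F t = Const (a t) * ((\<Prod>i<K. alternant (map Var (c i)) (es t i)) *
        (\<Prod>i\<in>{Suc K..<N}. column_monomial (c i) (es t i)))" for t
    have fixed: "perm_poly \<sigma> (F t) = F t" if \<sigma>: "\<And>v. v \<notin> set (c K) \<Longrightarrow> \<sigma> v = v" for \<sigma> t
    proof -
      have \<sigma>_id: "\<sigma> v = v" if "v \<in> set (c i)" "i < N" "i \<noteq> K" for v i
        using column_system_disjoint[OF c, of i K] Suc.prems that by (intro \<sigma>) auto
      have "perm_poly \<sigma> (alternant (map Var (c i)) (es t i)) =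
          (alternant (map Var (c i)) (es t i) :: 'k mvpoly)" if "i < N" "i \<noteq> K" for i
      proof -
        have "map (\<lambda>v. Var (\<sigma> v)) (c i) = (map Var (c i) :: 'k mvpoly list)"
          using \<sigma>_id that by simp
        then show ?thesis unfolding perm_poly_alternant by (rule arg_cong)
      qed
      moreover have "perm_poly \<sigma> (column_monomial (c i) (es t i)) =
          (column_monomial (c i) (es t i) :: 'k mvpoly)" if "i < N" "i \<noteq> K" for i
        using \<sigma>_id[OF _ that]
        by (simp add: column_monomial_def perm_poly.hom_prod perm_poly.hom_power)
      ultimately show ?thesis
        using Suc.prems by (simp add: F_def perm_poly.hom_mult perm_poly.hom_prod)
    qed
    have "{K..<N} = insert K {Suc K..<N}" using Suc.prems by auto
    then have "(\<Sum>t\<in>S. F t * column_monomial (c K) (es t K)) \<in> I"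
      using Suc by (simp add: F_def mult_ac)
    then have "(\<Sum>t\<in>S. F t * alternant (map Var (c K)) (es t K)) \<in> I"
      using Suc.prems c by (intro antisymmetrise_column[OF I _ _ fixed])
        (auto simp: column_system_distinct dest!: column_system_subset)
    then show ?case by (simp add: F_def mult_ac)
  qed
  from this[of N] show ?thesis by simp
qed

text \<open>Multiply the renamed polynomial \<open>P\<close> by the monomial with exponents \<open>y i k\<close> and antisymmetrise over
  every column. If each monomial of \<open>P\<close> other than \<open>m\<close> then has a repeated exponent in some
  column, only \<open>m\<close> survives, and it contributes a nonzero multiple of the product of the
  Vandermonde products; this is where the coefficients must be invertible.\<close>

lemma single_survivor_in_ideal:
  fixes I :: "'k::field mvpoly set" and y :: "nat \<Rightarrow> nat \<Rightarrow> nat"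
  assumes I: "symmetric_ideal n I" and c: "column_system n N c"
    and P: "P \<in> I" and m: "m \<in> Mon P" and \<sigma>: "\<sigma> permutes {1..n}"
    and \<rho>: "\<And>v. \<rho> (\<sigma> v) = v"
  defines "es \<equiv> \<lambda>t i. map (\<lambda>k. Poly_Mapping.lookup t (\<rho> (c i ! k)) + y i k) [0..<length (c i)]"
  assumes vanish: "\<And>t. t \<in> Mon P \<Longrightarrow> t \<noteq> m \<Longrightarrow> \<exists>i<N. \<not> distinct (es t i)"
    and survive: "\<And>i. i < N \<Longrightarrow> es m i = rev [0..<length (c i)]"
  shows "(\<Prod>i<N. vandermonde (map Var (c i))) \<in> I"
proof -
  let ?Y = "(\<Prod>i<N. \<Prod>k<length (c i). Var (c i ! k) ^ y i k) :: 'k mvpoly"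
  let ?a = "\<lambda>t. Poly_Mapping.lookup P t"
  let ?alt = "\<lambda>t. \<Prod>i<N. alternant (map Var (c i)) (es t i) :: 'k mvpoly"
  let ?V = "(\<Prod>i<N. vandermonde (map Var (c i))) :: 'k mvpoly"
  have mono: "?Y * (\<Prod>v\<in>mon_supp t. Var (\<sigma> v) ^ Poly_Mapping.lookup t v) =
      (\<Prod>i<N. column_monomial (c i) (es t i))" if t: "t \<in> Mon P" for t
  proof -
    have "mon_supp t \<subseteq> {1..n}"
      using symmetric_ideal_subset[OF I P] t by (auto simp: Supp_def)
    then have "(\<Prod>v\<in>mon_supp t. Var (\<sigma> v) ^ Poly_Mapping.lookup t v) =
        (\<Prod>v\<in>{1..n}. Var (\<sigma> v) ^ Poly_Mapping.lookup t v :: 'k mvpoly)"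
      by (intro perm_monomial_superset) auto
    also have "\<dots> = (\<Prod>v\<in>{1..n}. Var v ^ Poly_Mapping.lookup t (\<rho> v))"
      by (subst prod.permute[OF \<sigma>, where g = "\<lambda>v. Var v ^ Poly_Mapping.lookup t (\<rho> v)"])
        (simp add: o_def \<rho>)
    also have "\<dots> = (\<Prod>i<N. \<Prod>v\<leftarrow>c i. Var v ^ Poly_Mapping.lookup t (\<rho> v))"
      by (rule column_system_prod[OF c])
    also have "\<dots> = (\<Prod>i<N. \<Prod>k<length (c i). Var (c i ! k) ^ Poly_Mapping.lookup t (\<rho> (c i ! k)))"
      by (simp add: prod.list_conv_set_nth atLeast0LessThan)
    finally show ?thesis
      by (simp add: column_monomial_def es_def prod.distrib[symmetric] power_add mult.commute)
  qed
  have "?Y * perm_poly \<sigma> P \<in> I"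
  proof (intro symmetric_ideal_mult[OF I] symmetric_ideal_perm[OF I] P \<sigma> Supp_prod)
    fix i k assume "i \<in> {..<N}" "k \<in> {..<length (c i)}"
    then have "c i ! k \<in> {1..n}"
      using column_system_subset[OF c, of i] nth_mem[of k "c i"] by blast
    then show "Supp (Var (c i ! k) ^ y i k :: 'k mvpoly) \<subseteq> {1..n}"
      using Supp_power[of "Var (c i ! k)" "y i k"] Supp_Var[of "c i ! k"] by blast
  qed
  also have "?Y * perm_poly \<sigma> P =
      (\<Sum>t\<in>Mon P. Const (?a t) * (\<Prod>i<N. column_monomial (c i) (es t i)))"
    by (simp add: perm_poly_def sum_distrib_left mult.left_commute mono)
  finally have "(\<Sum>t\<in>Mon P. Const (?a t) * ?alt t) \<in> I"
    by (rule antisymmetrise_columns[OF I c])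
  also have "(\<Sum>t\<in>Mon P. Const (?a t) * ?alt t) = (\<Sum>t\<in>{m}. Const (?a t) * ?alt t)"
  proof (rule sum.mono_neutral_right)
    show "\<forall>t\<in>Mon P - {m}. Const (?a t) * ?alt t = 0"
    proof
      fix t assume "t \<in> Mon P - {m}"
      then obtain i where "i < N" "\<not> distinct (es t i)" using vanish by blast
      then have "\<exists>i\<in>{..<N}. alternant (map Var (c i)) (es t i) = (0 :: 'k mvpoly)"
        by (intro bexI[of _ i] alternant_repeated_exponent) (auto simp: es_def)
      then have "?alt t = 0" by (intro prod_zero) auto
      then show "Const (?a t) * ?alt t = 0" by simp
    qed
  qed (use m in \<open>auto simp: Mon_def\<close>)
  also have "\<dots> = Const (?a m) * ?V"
    using alternant_staircase[of "map Var (c i) :: 'k mvpoly list" for i] survive by simp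
  finally have "Const (?a m) * ?V \<in> I" .
  then have "Const (inverse (?a m)) * (Const (?a m) * ?V) \<in> I"
    by (rule symmetric_ideal_mult[OF I]) simp
  also have "Const (inverse (?a m)) * (Const (?a m) * ?V) = ?V"
    using m by (simp add: mult.assoc[symmetric] Const_mult[symmetric] Mon_def in_keys_iff) (simp add: Const_def)
  finally show ?thesis .
qed

section \<open>Columns of lengths given by the leading monomial\<close>

lemma Mon_hom_comp: "t \<in> Mon (hom_comp h P) \<longleftrightarrow> t \<in> Mon P \<and> mon_deg t = h"
proof -
  have "Poly_Mapping.lookup (hom_comp h P) t = (if t \<in> Mon P \<and> mon_deg t = h then Poly_Mapping.lookup P t else 0)"
    by (simp add: hom_comp_def lookup_sum lookup_single when_def Mon_def)
  then show ?thesis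
    by (auto simp: Mon_def in_keys_iff)
qed

lemma mon_deg_le_total_deg: "t \<in> Mon P \<Longrightarrow> mon_deg t \<le> total_deg P"
  unfolding total_deg_def by (rule Max_ge) (auto simp: Mon_def)

lemma mon_deg_superset:
  "finite S \<Longrightarrow> mon_supp t \<subseteq> S \<Longrightarrow> mon_deg t = (\<Sum>v\<in>S. Poly_Mapping.lookup t v)"
  unfolding mon_deg_def by (rule sum.mono_neutral_left) (auto simp: mon_supp_def in_keys_iff)

lemma monom_eqI_of_le:
  assumes "\<And>v. v \<in> mon_supp m \<Longrightarrow> Poly_Mapping.lookup m v \<le> Poly_Mapping.lookup t v"
    and "mon_deg t = mon_deg m"
  shows "t = m"
proof (rule poly_mapping_eqI)
  fix v
  let ?S = "insert v (mon_supp t \<union> mon_supp m)"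
  have fin: "finite ?S" by (simp add: mon_supp_def)
  have sums: "(\<Sum>v\<in>?S. Poly_Mapping.lookup m v) = (\<Sum>v\<in>?S. Poly_Mapping.lookup t v)"
    using assms(2) mon_deg_superset[OF fin, of t] mon_deg_superset[OF fin, of m]
    by (metis Un_upper1 Un_upper2 subset_insertI2)
  have "Poly_Mapping.lookup m w \<le> Poly_Mapping.lookup t w" for w
    using assms(1)[of w] by (cases "w \<in> mon_supp m") (auto simp: mon_supp_def in_keys_iff)
  then show "Poly_Mapping.lookup t v = Poly_Mapping.lookup m v"
    using sum_mono_inv[OF sums, of v] fin by simp
qed

lemma sum_list_distinct_ge:
  fixes es :: "nat list"
  assumes "distinct es"
  shows "sum_list [0..<length es] \<le> sum_list es"
proof -
  have "\<Sum>{0..<card A} \<le> \<Sum>A" if "finite A" for A :: "nat set"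
    using that
  proof (induction A rule: finite_linorder_max_induct)
    case (insert b A)
    have "A \<subseteq> {0..<b}" using insert by auto
    then have "card A \<le> b" using subset_eq_atLeast0_lessThan_card by blast
    moreover have "b \<notin> A" using insert by auto
    ultimately show ?case using insert by simp
  qed simp
  from this[of "set es"] show ?thesis
    using assms sum_list_distinct_conv_sum_set[OF assms, of "\<lambda>x. x"]
    by (simp add: distinct_card)
qed

lemma permutation_extending_lists:
  assumes "finite A" "distinct xs" "set xs \<subseteq> A" "distinct ys" "set ys \<subseteq> A" "length xs \<le> length ys"
  shows "\<exists>\<sigma>. \<sigma> permutes A \<and> (\<forall>i<length xs. \<sigma> (xs ! i) = ys ! i)"
proof -
  have extend: "\<exists>f. bij_betw f {..<card A} A \<and> (\<forall>i<length zs. f i = zs ! i)"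
    if "distinct zs" "set zs \<subseteq> A" for zs
  proof -
    obtain ws where ws: "set ws = A - set zs" "distinct ws"
      using finite_distinct_list[of "A - set zs"] assms(1) by blast
    let ?zs = "zs @ ws"
    have d: "distinct ?zs" and s: "set ?zs = A"
      using that ws by auto
    have "bij_betw ((!) ?zs) {..<card A} A"
      by (rule bij_betw_nth[OF d]) (use d s distinct_card[OF d] in auto)
    then show ?thesis by (intro exI[of _ "(!) ?zs"]) (simp add: nth_append)
  qed
  obtain f g where f: "bij_betw f {..<card A} A" "\<forall>i<length xs. f i = xs ! i"
    and g: "bij_betw g {..<card A} A" "\<forall>i<length ys. g i = ys ! i"
    using extend[OF assms(2,3)] extend[OF assms(4,5)] by blast
  let ?h = "g \<circ> inv_into {..<card A} f"
  define \<sigma> where "\<sigma> v = (if v \<in> A then ?h v else v)" for v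
  have "bij_betw ?h A A"
    by (rule bij_betw_trans[OF bij_betw_inv_into[OF f(1)] g(1)])
  then have "bij_betw \<sigma> A A"
    by (rule bij_betw_cong[THEN iffD1, rotated]) (simp add: \<sigma>_def)
  then have "\<sigma> permutes A"
    by (rule bij_imp_permutes) (simp add: \<sigma>_def)
  moreover have "\<sigma> (xs ! i) = ys ! i" if i: "i < length xs" for i
  proof -
    have "length xs \<le> card A"
      using assms(1-3) by (metis card_mono distinct_card)
    then have "inv_into {..<card A} f (f i) = i"
      using i f(1) by (intro inv_into_f_f) (auto simp: bij_betw_def)
    moreover have "xs ! i \<in> A" using assms(3) nth_mem[OF i] by blast
    ultimately show ?thesis
      using i f(2) g(2) assms(6) by (simp add: \<sigma>_def)
  qed
  ultimately show ?thesis by blast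
qed

lemma mon_exponents_enumeration:
  "\<exists>xs. distinct xs \<and> set xs = mon_supp m \<and> map (Poly_Mapping.lookup m) xs = mon_exponents m"
proof -
  let ?s = "sorted_list_of_set (mon_supp m)"
  let ?xs = "rev (sort_key (Poly_Mapping.lookup m) ?s)"
  have "map (Poly_Mapping.lookup m) (sort_key (Poly_Mapping.lookup m) ?s) = sort (map (Poly_Mapping.lookup m) ?s)"
    by (rule properties_for_sort[symmetric]) simp_all
  then have "map (Poly_Mapping.lookup m) ?xs = mon_exponents m"
    by (simp add: mon_exponents_def flip: rev_map)
  then show ?thesis
    by (intro exI[of _ ?xs]) (simp add: mon_supp_def)
qed

lemma length_mon_exponents: "length (mon_exponents m) = mon_wt m"
  by (simp add: mon_exponents_def mon_wt_def)

lemma sum_list_mon_exponents: "sum_list (mon_exponents m) = mon_deg m"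
proof -
  obtain xs where "distinct xs" "set xs = mon_supp m" "map (Poly_Mapping.lookup m) xs = mon_exponents m"
    using mon_exponents_enumeration by blast
  then show ?thesis
    by (metis mon_deg_def sum_list_distinct_conv_sum_set)
qed

lemma length_mu: "mon_deg m + mon_wt m \<le> n \<Longrightarrow> length (mu n m) = n - mon_deg m"
  by (simp add: mu_def length_mon_exponents)

lemma sum_list_mu: "mon_deg m + mon_wt m \<le> n \<Longrightarrow> sum_list (mu n m) = n"
  by (simp add: mu_def sum_list_Suc sum_list_replicate sum_list_mon_exponents length_mon_exponents)

lemma sorted_mu: "sorted_wrt (\<ge>) (mu n m)"
proof -
  have "sorted_wrt (\<ge>) (mon_exponents m)"
    by (simp add: mon_exponents_def sorted_wrt_rev)
  then show ?thesis
    by (simp add: mu_def sorted_wrt_append sorted_wrt_map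
        sorted_wrt_iff_nth_less[of _ "replicate _ _"])
qed

text \<open>Rename the variables so that those of the leading form \<open>hom_comp d P\<close> become heads of columns,
  the variables of \<open>m\<close> being heads of the columns whose length exceeds their exponent by one. The
  hypothesis on the weight says exactly that there are enough columns. Fill up each column, below
  its head, with the exponents \<open>\<dots>, 2, 1, 0\<close>; then \<open>m\<close> gets the exponents of the Vandermonde
  product in every column. A monomial \<open>t\<close> of \<open>P\<close> whose exponents are distinct in every
  column has at least the degree of \<open>m\<close>, because \<open>m\<close> leads to the smallest distinct exponents there
  are. So it belongs to the leading form and involves heads only, hence each head must have at
  least its exponent in \<open>m\<close>, since the smaller ones occur below it. For degree reasons \<open>t\<close>
  is \<open>m\<close>.\<close>

lemma mu_columns_in_ideal:
  fixes I :: "'k::field mvpoly set"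
  assumes I: "symmetric_ideal n I" and P: "P \<in> I" and d: "total_deg P = d"
    and wt: "d + wt (hom_comp d P) \<le> n" and m: "m \<in> Mon (hom_comp d P)"
    and c: "column_system n N c" and N: "length (mu n m) \<le> N"
    and len: "\<And>i. i < N \<Longrightarrow> length (c i) = (if i < length (mu n m) then mu n m ! i else 0)"
  shows "(\<Prod>i<N. vandermonde (map Var (c i))) \<in> I"
proof -
  have mP: "m \<in> Mon P" "mon_deg m = d" using m by (auto simp: Mon_hom_comp)
  obtain xs where xs: "distinct xs" "set xs = mon_supp m" "map (Poly_Mapping.lookup m) xs = mon_exponents m"
    using mon_exponents_enumeration by blast
  let ?S = "Supp (hom_comp d P)"
  have finS: "finite ?S" by (simp add: Supp_def Mon_def mon_supp_def)
  \<comment> \<open>All variables of the leading form, those of \<open>m\<close> first and in the order of the columns.\<close>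
  define zs where "zs = xs @ sorted_list_of_set (?S - mon_supp m)"
  have zs: "distinct zs" "set zs = ?S"
    using xs finS m by (auto simp: zs_def Supp_def)
  have len_zs: "length zs = wt (hom_comp d P)"
    using distinct_card[OF zs(1)] zs(2) by (simp add: wt_def)
  have len_xs: "length xs = mon_wt m"
    using distinct_card[OF xs(1)] xs(2) by (simp add: mon_wt_def)
  have zs_nth: "zs ! i = xs ! i" if "i < length xs" for i
    using that by (simp add: zs_def nth_append)
  have "length xs \<le> length zs" by (simp add: zs_def)
  then have wt_m: "mon_deg m + mon_wt m \<le> n"
    using wt mP len_xs len_zs by simp
  define L where "L = length (mu n m)"
  have L: "L = n - d" using length_mu[OF wt_m] mP by (simp add: L_def)
  have zs_L: "length zs \<le> L" using len_zs wt L by simp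
  have xs_L: "length xs \<le> L" using zs_L \<open>length xs \<le> length zs\<close> by simp
  have len_c: "length (c i) = (if i < length xs then Suc (Poly_Mapping.lookup m (xs ! i)) else if i < L then 1 else 0)"
    if "i < N" for i
  proof -
    have "mu n m ! i = (if i < length xs then Suc (Poly_Mapping.lookup m (xs ! i)) else 1)" if "i < L"
      using that by (auto simp: mu_def L_def nth_append len_xs length_mon_exponents xs(3)[symmetric])
    then show ?thesis using len[OF that] xs_L by (auto simp: L_def)
  qed
  have ne: "c i \<noteq> []" if "i < L" for i
    using len_c[of i] that N by (auto simp: L_def split: if_splits)
  have same: "i = j \<and> k = k'" if "i < N" "j < N" "k < length (c i)" "k' < length (c j)" "c i ! k = c j ! k'" for i j k k'
  proof -
    have "i = j"
      using column_system_disjoint[OF c that(1,2)] that(3-5) nth_mem by (metis disjoint_iff)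
    then show ?thesis
      using that column_system_distinct[OF c that(1)] by (simp add: nth_eq_iff_index_eq)
  qed
  define hs where "hs = map (\<lambda>i. c i ! 0) [0..<L]"
  have hs_nth: "hs ! i = c i ! 0" if "i < L" for i using that by (simp add: hs_def)
  have "distinct hs"
  proof -
    have "i = j" if "i < L" "j < L" "c i ! 0 = c j ! 0" for i j
      using same[of i j 0 0] ne that N by (simp add: L_def)
    then show ?thesis by (simp add: hs_def distinct_map inj_on_def)
  qed
  moreover have "set hs \<subseteq> {1..n}"
  proof
    fix v assume "v \<in> set hs"
    then obtain i where i: "i < L" "v = c i ! 0" by (auto simp: hs_def)
    then have "v \<in> set (c i)" using ne by simp
    then show "v \<in> {1..n}" using column_system_subset[OF c, of i] i N by (auto simp: L_def)
  qed
  moreover have "set zs \<subseteq> {1..n}"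
  proof -
    have "?S \<subseteq> Supp P" by (auto simp: Supp_def Mon_hom_comp)
    then show ?thesis using symmetric_ideal_subset[OF I P] zs(2) by blast
  qed
  ultimately obtain \<sigma> where \<sigma>: "\<sigma> permutes {1..n}" "\<forall>i<length zs. \<sigma> (zs ! i) = hs ! i"
    using permutation_extending_lists[of "{1..n}" zs hs] zs(1) zs_L by (auto simp: hs_def)
  define \<rho> where "\<rho> = inv_into UNIV \<sigma>"
  have \<rho>: "\<rho> (\<sigma> v) = v" "\<sigma> (\<rho> v) = v" for v
    using permutes_inverses[OF \<sigma>(1)] by (simp_all add: \<rho>_def)
  have \<rho>_head: "\<rho> (c i ! 0) = zs ! i" if "i < length zs" for i
    using \<sigma>(2) \<rho>(1) that zs_L hs_nth by (metis order_less_le_trans)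
  have only_heads: "k = 0 \<and> \<rho> (c i ! k) = zs ! i \<and> i < length zs"
    if ik: "i < N" "k < length (c i)" "\<rho> (c i ! k) \<in> ?S" for i k
  proof -
    obtain j where j: "j < length zs" "\<rho> (c i ! k) = zs ! j"
      using ik(3) zs(2) by (metis in_set_conv_nth)
    then have "c i ! k = c j ! 0" using \<rho>_head \<rho>(2) by metis
    moreover have "j < L" using j zs_L by simp
    ultimately show ?thesis using same[of i j k 0] ik ne[of j] j N by (auto simp: L_def)
  qed
  have tail_zero: "Poly_Mapping.lookup t (\<rho> (c i ! k)) = 0"
    if "t \<in> Mon (hom_comp d P)" "i < N" "k < length (c i)" "k \<noteq> 0" for t i k
  proof (rule ccontr)
    assume "Poly_Mapping.lookup t (\<rho> (c i ! k)) \<noteq> 0"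
    then have "\<rho> (c i ! k) \<in> ?S"
      using that(1) by (auto simp: Supp_def mon_supp_def in_keys_iff)
    then show False using only_heads that by blast
  qed
  \<comment> \<open>The head is left to the exponent of the monomial; the rest of the column descends to \<open>0\<close>.\<close>
  define y where "y i k = (if k = 0 then 0 else length (c i) - 1 - k)" for i k
  define es where "es t i = map (\<lambda>k. Poly_Mapping.lookup t (\<rho> (c i ! k)) + y i k) [0..<length (c i)]" for t i
  have survive: "es m i = rev [0..<length (c i)]" if i: "i < N" for i
  proof (rule nth_equalityI)
    fix k assume "k < length (es m i)"
    then have k: "k < length (c i)" by (simp add: es_def)
    have "Poly_Mapping.lookup m (\<rho> (c i ! k)) + y i k = length (c i) - 1 - k"
    proof (cases "k = 0")
      case True
      show ?thesis
      proof (cases "i < length xs")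
        case True
        then have "\<rho> (c i ! 0) = xs ! i"
          using \<rho>_head[of i] zs_nth \<open>length xs \<le> length zs\<close> by simp
        then show ?thesis using \<open>k = 0\<close> True len_c[OF i] by (simp add: y_def)
      next
        case False
        have "\<rho> (c i ! 0) \<notin> mon_supp m"
        proof
          assume a: "\<rho> (c i ! 0) \<in> mon_supp m"
          then have "\<rho> (c i ! k) \<in> ?S" using m True by (auto simp: Supp_def)
          from only_heads[OF i k this] have *: "zs ! i \<in> set xs" "i < length zs"
            using a xs(2) True by auto
          then obtain j where "j < length xs" "zs ! i = zs ! j"
            using zs_nth by (metis in_set_conv_nth)
          then show False
            using zs(1) * False \<open>length xs \<le> length zs\<close> by (simp add: nth_eq_iff_index_eq)
        qed
        then show ?thesis
          using \<open>k = 0\<close> False len_c[OF i] by (simp add: y_def mon_supp_def in_keys_iff)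
      qed
    next
      case False
      then show ?thesis using tail_zero[OF m i k] by (simp add: y_def)
    qed
    then show "es m i ! k = rev [0..<length (c i)] ! k"
      using k by (simp add: es_def rev_nth)
  qed (simp add: es_def)
  have weight: "(\<Sum>i<N. sum_list (es t i)) = mon_deg t + (\<Sum>i<N. \<Sum>k<length (c i). y i k)"
    if t: "t \<in> Mon P" for t
  proof -
    have "mon_supp t \<subseteq> {1..n}"
      using symmetric_ideal_subset[OF I P] t by (auto simp: Supp_def)
    then have "mon_deg t = (\<Sum>v\<in>{1..n}. Poly_Mapping.lookup t v)"
      by (intro mon_deg_superset) auto
    also have "\<dots> = (\<Sum>v\<in>{1..n}. Poly_Mapping.lookup t (\<rho> v))"
      by (subst sum.permute[OF \<sigma>(1), where g = "\<lambda>v. Poly_Mapping.lookup t (\<rho> v)"])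
        (simp add: o_def \<rho>)
    also have "\<dots> = (\<Sum>i<N. \<Sum>v\<leftarrow>c i. Poly_Mapping.lookup t (\<rho> v))"
      by (rule column_system_sum[OF c])
    also have "\<dots> = (\<Sum>i<N. \<Sum>k<length (c i). Poly_Mapping.lookup t (\<rho> (c i ! k)))"
      by (simp add: sum.list_conv_set_nth atLeast0LessThan)
    finally show ?thesis
      by (simp add: es_def interv_sum_list_conv_sum_set_nat sum.distrib atLeast0LessThan)
  qed
  have vanish: "\<exists>i<N. \<not> distinct (es t i)" if t: "t \<in> Mon P" "t \<noteq> m" for t
  proof (rule ccontr)
    assume "\<not> (\<exists>i<N. \<not> distinct (es t i))"
    then have dist: "distinct (es t i)" if "i < N" for i using that by blast
    have "(\<Sum>i<N. sum_list (es m i)) \<le> (\<Sum>i<N. sum_list (es t i))"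
      using sum_list_distinct_ge[OF dist] survive
      by (intro sum_mono) (simp add: es_def sum_list_rev)
    then have "d \<le> mon_deg t"
      using weight[OF t(1)] weight[OF mP(1)] mP(2) by simp
    then have deg: "mon_deg t = d"
      using mon_deg_le_total_deg[OF t(1)] d by simp
    then have tP: "t \<in> Mon (hom_comp d P)" using t by (simp add: Mon_hom_comp)
    have "t = m"
    proof (rule monom_eqI_of_le)
      fix v assume "v \<in> mon_supp m"
      then obtain i where i: "i < length xs" "v = xs ! i"
        using xs(2) by (metis in_set_conv_nth)
      then have iN: "i < N" "i < length zs" using xs_L N \<open>length xs \<le> length zs\<close> by (auto simp: L_def)
      have lc: "length (c i) = Suc (Poly_Mapping.lookup m v)"
        using len_c[OF iN(1)] i by simp
      have head: "es t i ! 0 = Poly_Mapping.lookup t v"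
        using \<rho>_head[OF iN(2)] zs_nth i lc by (simp add: es_def y_def del: upt_Suc)
      show "Poly_Mapping.lookup m v \<le> Poly_Mapping.lookup t v"
      proof (rule ccontr)
        assume *: "\<not> ?thesis"
        \<comment> \<open>The position below the head that carries the same exponent as the head.\<close>
        let ?k = "length (c i) - 1 - Poly_Mapping.lookup t v"
        have k: "?k < length (c i)" "?k \<noteq> 0" using * lc by auto
        then have "es t i ! ?k = Poly_Mapping.lookup t v"
          using tail_zero[OF tP iN(1) k] * lc by (simp add: es_def y_def del: upt_Suc)
        moreover have "length (es t i) = length (c i)" by (simp add: es_def)
        ultimately show False
          using head k dist[OF iN(1)] nth_eq_iff_index_eq[of "es t i" 0 ?k] by (metis gr0I not_less_zero)
      qed
    qed (simp add: deg mP)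
    then show False using t by simp
  qed
  show ?thesis
    by (rule single_survivor_in_ideal[OF I c P mP(1) \<sigma>(1) \<rho>(1), of y])
      (use vanish survive in \<open>simp_all add: es_def\<close>)
qed

section \<open>Moving boxes between columns\<close>

lemma column_system_length:
  assumes "column_system n N c"
  shows "(\<Sum>i<N. length (c i)) = n"
  using column_system_sum[OF assms, of "\<lambda>_. 1 :: nat"] by (simp add: sum_list_triv)

text \<open>With \<open>e\<close> chosen to reach the critical degree, the Vandermonde products of the old columns are
  a combination of those of all systems obtained by moving one entry of column \<open>i\<close> to
  column \<open>j\<close>. Such an exponent exists because column \<open>j\<close> is shorter.\<close>

lemma box_move_in_ideal:
  fixes I :: "'k::comm_ring_1 mvpoly set"
  assumes I: "symmetric_ideal n I" and c: "column_system n N c"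
    and ij: "i < N" "j < N" "i \<noteq> j" and shorter: "length (c j) < length (c i)"
    and moved: "\<And>k. k < length (c i) \<Longrightarrow>
      (\<Prod>l<N. vandermonde (map Var ((c(i := delete_nth k (c i), j := (c i ! k) # c j)) l))) \<in> I"
  shows "(\<Prod>l<N. vandermonde (map Var (c l))) \<in> I"
proof -
  let ?R = "(\<Prod>l\<in>{..<N} - {i} - {j}. vandermonde (map Var (c l))) :: 'k mvpoly"
  let ?x = "\<lambda>k. Var (c i ! k) :: 'k mvpoly"
  let ?xs = "map Var (c i) :: 'k mvpoly list"
  define e where "e = length (c i) - 1 - length (c j)"
  have split: "(\<Prod>l<N. f l) = f i * (f j * (\<Prod>l\<in>{..<N} - {i} - {j}. f l))" for f :: "nat \<Rightarrow> 'k mvpoly"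
    using ij by (simp add: prod.remove[of "{..<N}" i] prod.remove[of "{..<N} - {i}" j])
  have "(\<Sum>k<length (c i). (- 1) ^ k * ?x k ^ e *
      (\<Prod>l<N. vandermonde (map Var ((c(i := delete_nth k (c i), j := (c i ! k) # c j)) l)))) \<in> I"
  proof (rule symmetric_ideal_sum[OF I], rule symmetric_ideal_mult[OF I moved])
    fix k assume "k \<in> {..<length (c i)}"
    then have "c i ! k \<in> {1..n}"
      using column_system_subset[OF c ij(1)] nth_mem[of k "c i"] by blast
    then have "Supp (?x k ^ e) \<subseteq> {1..n}"
      using Supp_power[of "?x k" e] Supp_Var[of "c i ! k"] by blast
    moreover have "Supp ((- 1) ^ k :: 'k mvpoly) = {}"
      using Supp_of_int[of "(- 1) ^ k"] by simp
    ultimately show "Supp ((- 1) ^ k * ?x k ^ e) \<subseteq> {1..n}"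
      using Supp_mult[of "(- 1) ^ k" "?x k ^ e"] by blast
  qed simp
  also have "(\<Sum>k<length (c i). (- 1) ^ k * ?x k ^ e *
      (\<Prod>l<N. vandermonde (map Var ((c(i := delete_nth k (c i), j := (c i ! k) # c j)) l)))) =
    (\<Sum>k<length ?xs. (- 1) ^ k * ?xs ! k ^ e *
      ((\<Prod>t\<leftarrow>map Var (c j). ?xs ! k - t) * vandermonde (delete_nth k ?xs))) *
      (vandermonde (map Var (c j)) * ?R)"
  proof -
    have "(\<Prod>l\<in>{..<N} - {i} - {j}. vandermonde (map Var ((c(i := delete_nth k (c i), j := (c i ! k) # c j)) l))) = ?R" for k
      by (rule prod.cong) auto
    then show ?thesis
      unfolding split sum_distrib_right using ij
      by (intro sum.cong) (simp_all add: delete_nth_def take_map drop_map o_def mult_ac)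
  qed
  also have "\<dots> = vandermonde (map Var (c i)) * (vandermonde (map Var (c j)) * ?R)"
    using vandermonde_box_move[of e "map Var (c j) :: 'k mvpoly list" "map Var (c i)"] shorter
    by (simp add: e_def)
  also have "\<dots> = (\<Prod>l<N. vandermonde (map Var (c l)))"
    by (rule split[symmetric])
  finally show ?thesis .
qed

lemma column_system_box_move:
  assumes c: "column_system n N c" and ij: "i < N" "j < N" "i \<noteq> j" and k: "k < length (c i)"
  shows "column_system n N (c(i := delete_nth k (c i), j := (c i ! k) # c j))"
proof -
  let ?c = "c(i := delete_nth k (c i), j := (c i ! k) # c j)"
  have split: "(\<Sum>l<N. f l) = f i + (f j + (\<Sum>l\<in>{..<N} - {i} - {j}. f l))" for f :: "nat \<Rightarrow> nat multiset"
    using ij by (simp add: sum.remove[of "{..<N}" i] sum.remove[of "{..<N} - {i}" j])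
  have "(\<Sum>l\<in>{..<N} - {i} - {j}. mset (?c l)) = (\<Sum>l\<in>{..<N} - {i} - {j}. mset (c l))"
    by (rule sum.cong) auto
  moreover have "mset (?c i) + mset (?c j) = mset (c i) + mset (c j)"
    using ij mset_delete_nth[OF k] by (metis add_mset_add_single fun_upd_other fun_upd_same
        mset.simps(2) union_mset_add_mset_left union_mset_add_mset_right)
  ultimately have "(\<Sum>l<N. mset (?c l)) = (\<Sum>l<N. mset (c l))"
    unfolding split by (simp add: add.assoc[symmetric] del: fun_upd_apply)
  then show ?thesis using c by (simp add: column_system_def)
qed

text \<open>Descent in the dominance order. If the lengths are not yet \<open>M\<close>, let \<open>j\<close> be the first column
  that is too short. Comparing prefix sums up to \<open>j\<close>, some earlier column \<open>i\<close> is too long, and it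
  is longer than column \<open>j\<close> because \<open>M\<close> decreases. Moving a box from \<open>i\<close> to \<open>j\<close> keeps the dominance:
  before \<open>j\<close> all columns remain long enough, and prefix sums beyond \<open>j\<close> do not change. The
  total excess over \<open>M\<close> drops by one.\<close>

lemma dominating_columns_in_ideal:
  fixes I :: "'k::comm_ring_1 mvpoly set" and M :: "nat \<Rightarrow> nat"
  assumes I: "symmetric_ideal n I"
    and base: "\<And>c. column_system n N c \<Longrightarrow> (\<And>i. i < N \<Longrightarrow> length (c i) = M i) \<Longrightarrow>
      (\<Prod>i<N. vandermonde (map Var (c i))) \<in> I"
    and anti: "\<And>i j. i < j \<Longrightarrow> j < N \<Longrightarrow> M j \<le> M i" and total: "(\<Sum>i<N. M i) = n"
    and c: "column_system n N c"
    and dom: "\<And>K. K \<le> N \<Longrightarrow> (\<Sum>i<K. M i) \<le> (\<Sum>i<K. length (c i))"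
  shows "(\<Prod>i<N. vandermonde (map Var (c i))) \<in> I"
  using c dom
proof (induction "\<Sum>i<N. length (c i) - M i" arbitrary: c rule: less_induct)
  case less
  note c = less.prems(1) and dom = less.prems(2)
  show ?case
  proof (cases "\<exists>j<N. length (c j) < M j")
    case False
    have sums: "(\<Sum>i<N. M i) = (\<Sum>i<N. length (c i))"
      using total column_system_length[OF c] by simp
    have "M i \<le> length (c i)" if "i < N" for i
      using False that by (metis not_le)
    then have "length (c i) = M i" if "i < N" for i
      using sum_mono_inv[OF sums, of i] that by simp
    then show ?thesis by (intro base c)
  next
    case True
    define j where "j = (LEAST j. j < N \<and> length (c j) < M j)"
    have j: "j < N" "length (c j) < M j"
      using LeastI_ex[OF True] by (auto simp: j_def)
    have before: "M l \<le> length (c l)" if "l < j" for l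
      using not_less_Least[of l "\<lambda>j. j < N \<and> length (c j) < M j"] that j by (auto simp: j_def)
    have "\<exists>i<j. M i < length (c i)"
    proof (rule ccontr)
      assume "\<not> ?thesis"
      then have "(\<Sum>l<j. length (c l)) \<le> (\<Sum>l<j. M l)"
        by (intro sum_mono) (metis lessThan_iff not_le)
      then show False using dom[of "Suc j"] j by simp
    qed
    then obtain i where i: "i < j" "M i < length (c i)" by blast
    have iN: "i < N" "i \<noteq> j" using i j by auto
    have shorter: "length (c j) < length (c i)"
      using anti[OF i(1) j(1)] i j by simp
    show ?thesis
    proof (rule box_move_in_ideal[OF I c iN(1) j(1) iN(2) shorter])
      fix k assume k: "k < length (c i)"
      let ?c = "c(i := delete_nth k (c i), j := (c i ! k) # c j)"
      have len: "length (?c l) = (if l = i then length (c i) - 1 else if l = j then Suc (length (c j)) else length (c l))" for l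
        using k iN by (simp add: length_delete_nth)
      show "(\<Prod>l<N. vandermonde (map Var (?c l))) \<in> I"
      proof (rule less.hyps)
        show "(\<Sum>l<N. length (?c l) - M l) < (\<Sum>l<N. length (c l) - M l)"
        proof (rule sum_strict_mono_ex1)
          show "\<forall>l\<in>{..<N}. length (?c l) - M l \<le> length (c l) - M l"
            unfolding len using j by auto
          show "\<exists>l\<in>{..<N}. length (?c l) - M l < length (c l) - M l"
            unfolding len using i iN by (intro bexI[of _ i]) auto
        qed simp
        show "column_system n N ?c"
          by (rule column_system_box_move[OF c iN(1) j(1) iN(2) k])
        show "(\<Sum>l<K. M l) \<le> (\<Sum>l<K. length (?c l))" if K: "K \<le> N" for K
        proof (cases "K \<le> j")
          case True
          then show ?thesis
            unfolding len using before i by (intro sum_mono) (auto simp: less_imp_le_nat)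
        next
          case False
          have split: "(\<Sum>l<K. f l) = f i + (f j + (\<Sum>l\<in>{..<K} - {i} - {j}. f l))" for f :: "nat \<Rightarrow> nat"
            using False i iN by (simp add: sum.remove[of "{..<K}" i] sum.remove[of "{..<K} - {i}" j])
          have "(\<Sum>l\<in>{..<K} - {i} - {j}. length (?c l)) = (\<Sum>l\<in>{..<K} - {i} - {j}. length (c l))"
            by (rule sum.cong) auto
          moreover have "length (?c i) + length (?c j) = length (c i) + length (c j)"
            unfolding len using k iN by auto
          ultimately have "(\<Sum>l<K. length (?c l)) = (\<Sum>l<K. length (c l))"
            unfolding split by linarith
          then show ?thesis using dom[OF K] by simp
        qed
      qed
    qed
  qed
qed

section \<open>Dominance and duality\<close>

text \<open>The first \<open>r\<close> columns of a diagram contain \<open>min x r\<close> boxes of a row of length \<open>x\<close>.\<close>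

lemma sum_list_take_dual_partition:
  "sum_list (take r (dual_partition \<mu>)) = (\<Sum>x\<leftarrow>\<mu>. min x r)"
proof -
  let ?M = "Max (insert 0 (set \<mu>))"
  have take: "take r [1..<Suc k] = [1..<Suc (min r k)]" for k
    by (cases "r \<le> k") (simp_all add: take_upt del: upt_Suc)
  have "sum_list (take r (dual_partition \<mu>)) =
      (\<Sum>i\<in>{1..min r ?M}. card {j. j < length \<mu> \<and> i \<le> \<mu> ! j})"
    unfolding dual_partition_def take_map take
    by (simp add: interv_sum_list_conv_sum_set_nat atLeastLessThanSuc_atLeastAtMost del: upt_Suc)
  also have "\<dots> = (\<Sum>i\<in>{1..min r ?M}. \<Sum>j<length \<mu>. if i \<le> \<mu> ! j then 1 else 0)"
    by (simp add: sum.If_cases Collect_conj_eq lessThan_def)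
  also have "\<dots> = (\<Sum>j<length \<mu>. \<Sum>i\<in>{1..min r ?M}. if i \<le> \<mu> ! j then 1 else 0)"
    by (rule sum.swap)
  also have "\<dots> = (\<Sum>j<length \<mu>. min (\<mu> ! j) r)"
  proof (rule sum.cong)
    fix j assume "j \<in> {..<length \<mu>}"
    then have "\<mu> ! j \<le> ?M" by (intro Max_ge) auto
    then have "{1..min r ?M} \<inter> {i. i \<le> \<mu> ! j} = {1..min (\<mu> ! j) r}" by auto
    then show "(\<Sum>i\<in>{1..min r ?M}. if i \<le> \<mu> ! j then 1 else 0) = min (\<mu> ! j) r"
      by (simp add: sum.If_cases)
  qed simp
  also have "\<dots> = (\<Sum>x\<leftarrow>\<mu>. min x r)"
    by (simp add: sum.list_conv_set_nth atLeast0LessThan)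
  finally show ?thesis .
qed

text \<open>Duality reverses the dominance order. Let \<open>r\<close> be the number of rows of \<open>lam\<close> that are longer
  than \<open>K\<close>. The boxes of \<open>lam\<close> outside the first \<open>K\<close> columns are those of the first \<open>r\<close> rows,
  except for \<open>r * K\<close> of them. Dominance bounds the first \<open>r\<close> rows by those of the dual
  of \<open>\<mu>\<close>, to which the first \<open>K\<close> parts of \<open>\<mu>\<close> contribute at most \<open>r * K\<close> boxes and the other
  parts at most their sum. So \<open>lam\<close> has at most as many boxes outside its first \<open>K\<close> columns as
  \<open>\<mu>\<close> has beyond its first \<open>K\<close> parts.\<close>

lemma dominated_dual_partition_prefix_sums:
  assumes lam: "is_partition lam n" and \<mu>: "sum_list \<mu> = n"
    and dom: "dominated lam (dual_partition \<mu>)"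
  shows "sum_list (take K \<mu>) \<le> (\<Sum>x\<leftarrow>lam. min x K)"
proof -
  let ?A = "takeWhile (\<lambda>x. K < x) lam" and ?B = "dropWhile (\<lambda>x. K < x) lam"
  define r where "r = length ?A"
  have total: "sum_list ?A + sum_list ?B = n"
    using lam by (metis is_partition_def sum_list_append takeWhile_dropWhile_id)
  have A: "?A = take r lam" by (simp add: r_def takeWhile_eq_take[symmetric])
  have "(\<Sum>x\<leftarrow>?A. min x K) = r * K"
  proof -
    have "map (\<lambda>x. min x K) ?A = map (\<lambda>x. K) ?A"
      by (rule map_cong) (auto dest: set_takeWhileD)
    then show ?thesis by (simp only:) (simp add: r_def sum_list_triv)
  qed
  moreover have "(\<Sum>x\<leftarrow>?B. min x K) = sum_list ?B"
  proof -
    have "x \<le> K" if "x \<in> set ?B" for x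
    proof -
      have "sorted_wrt (\<ge>) ?B"
        using lam by (auto simp: is_partition_def sorted_wrt_dropWhile)
      moreover have "?B \<noteq> []" using that by (metis empty_iff empty_set)
      then have "hd ?B \<le> K" using hd_dropWhile[of "\<lambda>x. K < x" lam] by simp
      ultimately show ?thesis using that by (cases ?B) auto
    qed
    then have "map (\<lambda>x. min x K) ?B = ?B" by (intro map_idI) auto
    then show ?thesis by simp
  qed
  moreover have "(\<Sum>x\<leftarrow>lam. min x K) = (\<Sum>x\<leftarrow>?A. min x K) + (\<Sum>x\<leftarrow>?B. min x K)"
    by (metis map_append sum_list_append takeWhile_dropWhile_id)
  ultimately have lam_sum: "(\<Sum>x\<leftarrow>lam. min x K) = r * K + sum_list ?B" by simp
  have "sum_list (take r lam) \<le> (\<Sum>x\<leftarrow>\<mu>. min x r)"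
  proof (cases "r \<le> length (dual_partition \<mu>)")
    case True
    have "r \<le> length lam" unfolding r_def by (rule length_takeWhile_le)
    then have "sum_list (take r lam) \<le> sum_list (take r (dual_partition \<mu>))"
      using dom True by (cases "r = 0") (auto simp: dominated_def)
    then show ?thesis by (simp add: sum_list_take_dual_partition)
  next
    case False
    moreover have "length (dual_partition \<mu>) = Max (insert 0 (set \<mu>))"
      by (simp add: dual_partition_def del: upt_Suc)
    ultimately have "Max (insert 0 (set \<mu>)) < r" by linarith
    then have "min x r = x" if "x \<in> set \<mu>" for x
      using Max_ge[of "insert 0 (set \<mu>)" x] that by simp
    then have "map (\<lambda>x. min x r) \<mu> = \<mu>" by (intro map_idI) auto
    then show ?thesis using total \<mu> A by simp
  qed
  also have "\<dots> \<le> r * K + sum_list (drop K \<mu>)"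
  proof -
    have "(\<Sum>x\<leftarrow>\<mu>. min x r) = (\<Sum>x\<leftarrow>take K \<mu>. min x r) + (\<Sum>x\<leftarrow>drop K \<mu>. min x r)"
      by (metis append_take_drop_id map_append sum_list_append)
    also have "(\<Sum>x\<leftarrow>take K \<mu>. min x r) \<le> (\<Sum>x\<leftarrow>take K \<mu>. r)"
      by (rule sum_list_mono) simp
    also have "(\<Sum>x\<leftarrow>take K \<mu>. r) \<le> r * K" by (simp add: sum_list_triv)
    also have "(\<Sum>x\<leftarrow>drop K \<mu>. min x r) \<le> sum_list (drop K \<mu>)"
      using sum_list_mono[of "drop K \<mu>" "\<lambda>x. min x r" "\<lambda>x. x"] by simp
    finally show ?thesis by simp
  qed
  finally have "sum_list ?A \<le> r * K + sum_list (drop K \<mu>)" by (simp add: A)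
  moreover have "sum_list (take K \<mu>) + sum_list (drop K \<mu>) = n"
    using \<mu> by (metis append_take_drop_id sum_list_append)
  ultimately show ?thesis using total lam_sum by linarith
qed

section \<open>Tableaux\<close>

text \<open>Agrees with the entries of \<open>List.transpose T\<close> but is also defined, and empty, beyond the last
  column.\<close>

definition tableau_column :: "nat list list \<Rightarrow> nat \<Rightarrow> nat list" where
  "tableau_column T i = map (\<lambda>row. row ! i) (filter (\<lambda>row. i < length row) T)"

lemma sum_length_tableau_column:
  "(\<Sum>i<K. length (tableau_column T i)) = (\<Sum>row\<leftarrow>T. min (length row) K)"
proof (induction T)
  case (Cons row T)
  have "(\<Sum>i<K. if i < length row then 1 else 0) = min (length row) K"
  proof -
    have "{..<K} \<inter> {i. i < length row} = {..<min (length row) K}" by auto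
    then show ?thesis by (simp add: sum.If_cases)
  qed
  moreover have "length (tableau_column (row # T) i) =
      (if i < length row then 1 else 0) + length (tableau_column T i)" for i
    by (simp add: tableau_column_def)
  ultimately show ?case using Cons by (simp add: sum.distrib)
qed (simp add: tableau_column_def)

lemma mset_tableau_columns:
  assumes "\<And>row. row \<in> set T \<Longrightarrow> length row \<le> N"
  shows "(\<Sum>i<N. mset (tableau_column T i)) = mset (concat T)"
  using assms
proof (induction T)
  case (Cons row T)
  have "mset row = (\<Sum>i<length row. {#row ! i#})"
    by (induction row rule: rev_induct) (simp_all add: nth_append)
  also have "\<dots> = (\<Sum>i<N. if i < length row then {#row ! i#} else {#})"
    by (rule sum.mono_neutral_cong_left) (use Cons.prems[of row] in auto)
  finally have row: "(\<Sum>i<N. if i < length row then {#row ! i#} else {#}) = mset row" by simp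
  have "mset (tableau_column (row # T) i) =
      (if i < length row then {#row ! i#} else {#}) + mset (tableau_column T i)" for i
    by (simp add: tableau_column_def)
  then show ?case using Cons row by (simp add: sum.distrib)
qed (simp add: tableau_column_def)

lemma Delta_eq_vandermonde: "Delta S = vandermonde (map Var S)"
proof (induction S)
  case Nil
  then show ?case by (simp add: Delta_def)
next
  case (Cons x S)
  let ?P = "{(j, k). j < k \<and> k < length S}"
  have fin: "finite ?P" by (rule finite_subset[of _ "{..<length S} \<times> {..<length S}"]) auto
  have pairs: "{(j, k). j < k \<and> k < length (x # S)} =
      (\<lambda>k. (0, Suc k)) ` {..<length S} \<union> (\<lambda>(j, k). (Suc j, Suc k)) ` ?P" (is "?Q = ?A \<union> ?B")
  proof
    show "?Q \<subseteq> ?A \<union> ?B"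
    proof
      fix p assume "p \<in> ?Q"
      then obtain j k where p: "p = (j, Suc k)" "j < Suc k" "k < length S"
        by (cases p, cases "snd p") auto
      then show "p \<in> ?A \<union> ?B" by (cases j) (auto simp: image_iff)
    qed
  qed auto
  have "Delta (x # S) = (\<Prod>k<length S. Var x - Var (S ! k)) * (Delta S :: 'a mvpoly)"
    unfolding Delta_def pairs
    by (subst prod.union_disjoint)
      (auto simp: fin prod.reindex inj_on_def case_prod_beta simp del: length_Cons)
  then show ?case
    using Cons by (simp add: prod.list_conv_set_nth atLeast0LessThan)
qed

lemma specht_eq_prod_columns:
  assumes "\<And>row. row \<in> set T \<Longrightarrow> length row \<le> N"
  shows "specht T = (\<Prod>i<N. vandermonde (map Var (tableau_column T i)))"
proof -
  let ?L = "length (List.transpose T)"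
  have "?L \<le> N"
    unfolding length_transpose using assms by (induction T) auto
  have nth: "List.transpose T ! i = tableau_column T i" if "i < ?L" for i
    using nth_transpose[OF that] by (simp add: tableau_column_def)
  have beyond: "tableau_column T i = []" if "?L \<le> i" for i
  proof -
    have "length row \<le> ?L" if "row \<in> set T" for row
      unfolding length_transpose using that by (induction T) auto
    then show ?thesis using that by (force simp: tableau_column_def filter_empty_conv)
  qed
  have "specht T = (\<Prod>i<?L. vandermonde (map Var (tableau_column T i)))"
    by (simp add: specht_def prod.list_conv_set_nth atLeast0LessThan Delta_eq_vandermonde nth)
  also have "\<dots> = (\<Prod>i<N. vandermonde (map Var (tableau_column T i)))"
    by (rule prod.mono_neutral_left) (use \<open>?L \<le> N\<close> beyond in auto)
  finally show ?thesis .
qed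

section \<open>Specht polynomials in symmetric ideals\<close>

theorem theorem2:
  fixes n d :: nat and I :: "'k::field mvpoly set" and P :: "'k mvpoly" and m :: monom
  assumes "symmetric_ideal n I"
    and "P \<in> I" and "total_deg P = d"
    and "d + wt (hom_comp d P) \<le> n"
    and "m \<in> Mon (hom_comp d P)"
  shows "(\<forall>lam T. is_partition lam n \<and> is_tableau n lam T \<and> dominated lam (dual_partition (mu n m))
            \<longrightarrow> specht T \<in> I) \<and>
         (\<forall>lam. is_partition lam n \<and> dominated lam (dual_partition (mu n m))
            \<longrightarrow> specht_ideal n lam \<subseteq> I)"
proof -
  have "mon_supp m \<subseteq> Supp (hom_comp d P)" "finite (Supp (hom_comp d P))"
    using assms(5) by (auto simp: Supp_def Mon_def mon_supp_def)
  then have "mon_wt m \<le> wt (hom_comp d P)"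
    by (simp add: mon_wt_def wt_def card_mono)
  then have wt_m: "mon_deg m + mon_wt m \<le> n"
    using assms(4,5) by (simp add: Mon_hom_comp)
  have main: "specht T \<in> I"
    if lam: "is_partition lam n" and T: "is_tableau n lam T"
      and dom: "dominated lam (dual_partition (mu n m))" for lam T
  proof -
    \<comment> \<open>Large enough for the columns of both shapes.\<close>
    define N where "N = length (mu n m) + n"
    define M where "M i = (if i < length (mu n m) then mu n m ! i else 0)" for i
    have M_sum: "(\<Sum>i<K. M i) = sum_list (take K (mu n m))" for K
    proof -
      have "(\<Sum>i<K. M i) = (\<Sum>i<min (length (mu n m)) K. mu n m ! i)"
        by (rule sum.mono_neutral_cong_right) (auto simp: M_def)
      then show ?thesis
        by (simp add: sum.list_conv_set_nth[of "take K (mu n m)"] atLeast0LessThan)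
    qed
    have row_le: "length row \<le> N" if "row \<in> set T" for row
    proof -
      have "length row \<in> set lam" using T that by (auto simp: is_tableau_def)
      then have "length row \<le> n" using lam member_le_sum_list[of "length row" lam] by (simp add: is_partition_def)
      then show ?thesis by (simp add: N_def)
    qed
    have "mset (concat T) = mset_set {1..n}"
      using T by (metis is_tableau_def mset_set_set)
    then have c: "column_system n N (tableau_column T)"
      using mset_tableau_columns[OF row_le] by (simp add: column_system_def)
    have "(\<Prod>i<N. vandermonde (map Var (tableau_column T i))) \<in> I"
    proof (rule dominating_columns_in_ideal[OF assms(1) _ _ _ c, where M = M])
      show "(\<Prod>i<N. vandermonde (map Var (c i))) \<in> I"
        if "column_system n N c" "\<And>i. i < N \<Longrightarrow> length (c i) = M i" for c
        by (rule mu_columns_in_ideal[OF assms that(1)]) (use that(2) in \<open>simp_all add: M_def N_def\<close>)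
      show "M j \<le> M i" if "i < j" for i j
        using that sorted_wrt_nth_less[OF sorted_mu, of i j n m] by (auto simp: M_def)
      show "(\<Sum>i<N. M i) = n"
        unfolding M_sum using sum_list_mu[OF wt_m] by (simp add: N_def)
      show "(\<Sum>i<K. M i) \<le> (\<Sum>i<K. length (tableau_column T i))" for K
      proof -
        have "(\<Sum>x\<leftarrow>lam. min x K) = (\<Sum>row\<leftarrow>T. min (length row) K)"
          using T by (auto simp: is_tableau_def o_def)
        then show ?thesis
          unfolding M_sum sum_length_tableau_column
          using dominated_dual_partition_prefix_sums[OF lam sum_list_mu[OF wt_m] dom, of K] by simp
      qed
    qed
    then show ?thesis
      by (simp add: specht_eq_prod_columns[OF row_le])
  qed
  moreover have "specht_ideal n lam \<subseteq> I"
    if "is_partition lam n" "dominated lam (dual_partition (mu n m))" for lam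
  proof -
    interpret cring "poly_ring n :: 'k mvpoly ring" by (rule cring_poly_ring)
    have "ideal I (poly_ring n)" using assms(1) by (simp add: symmetric_ideal_def)
    then show ?thesis
      unfolding specht_ideal_def by (rule genideal_minimal) (use main that in blast)
  qed
  ultimately show ?thesis by blast
qed

end
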